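(* Let $(X,\mathcal{T})$ be a topological space, let $\mathcal{P}$ be a subbase for $\mathcal{T}$ with $X\in\mathcal{P}$, and let $\mathcal{O}=\mathcal{O}_{\mathcal{P}}^{CL(X)}$. For any $A\subseteq X$ (equipped with the subspace topology), set $\mathcal{P}_A=\{U\cap A\mid U\in\mathcal{P}\}$ and $\mathcal{O}_A=\mathcal{O}_{\mathcal{P}_A}^{CL(A)}$. Then the map $i_{A,X}:(CL(A),\mathcal{O}_A)\to(CL(X),\mathcal{O})$, defined by $i_{A,X}(F)=\overline{F}^X$, is a homeomorphic embedding.
   Context: For a topological space $Y$, $CL(Y)$ is the set of all non-empty closed subsets of $Y$, and $\overline{F}^X$ is the closure of $F$ in $X$. For a set $Y$, a family $\mathcal{M}$ of non-empty subsets of $Y$ and $B\subseteq Y$, put $B_{\mathcal{M}}^-=\{M\in\mathcal{M}\mid M\cap B\neq\emptyset\}$. For a family $\mathcal{S}$ of subsets of $Y$ such that every $M\in\mathcal{M}$ meets $\bigcup\mathcal{S}$, $\mathcal{O}_{\mathcal{S}}^{\mathcal{M}}$ denotes the topology on $\mathcal{M}$ having $\{B_{\mathcal{M}}^-\mid B\in\mathcal{S}\}$ as a subbase. *)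

theory Defs
  imports "HOL-Analysis.Analysis"
begin

definition CL :: "'a topology \<Rightarrow> 'a set set" where
  "CL Y = {F. closedin Y F \<and> F \<noteq> {}}"

definition hit :: "'a set set \<Rightarrow> 'a set \<Rightarrow> 'a set set" where
  "hit M B = {F \<in> M. F \<inter> B \<noteq> {}}"

(* The topspace of topology_generated_by S is \<Union>S, so this notion of subbase asks P to
   cover the space; nothing is lost for subbases that contain the whole space. *)
definition subbase_of :: "'a topology \<Rightarrow> 'a set set \<Rightarrow> bool" where
  "subbase_of T P \<longleftrightarrow> topology_generated_by P = T"

(* This is a topology on all of M only if every member of M meets \<Union>S
   (see topspace_hit_topology). *)
definition hit_topology :: "'a set set \<Rightarrow> 'a set set \<Rightarrow> 'a set topology" where
  "hit_topology M S = topology_generated_by (hit M ` S)"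

lemma topspace_hit_topology:
  assumes "\<And>F. F \<in> M \<Longrightarrow> F \<inter> \<Union>S \<noteq> {}"
  shows "topspace (hit_topology M S) = M"
  using assms unfolding hit_topology_def topology_generated_by_topspace hit_def by blast

lemma topspace_hit_topology_CL:
  assumes "topspace Y \<in> S"
  shows "topspace (hit_topology (CL Y) S) = CL Y"
proof (rule topspace_hit_topology)
  fix F assume "F \<in> CL Y"
  then show "F \<inter> \<Union>S \<noteq> {}"
    using assms closedin_subset[of Y F] by (fastforce simp: CL_def)
qed

definition trace_family :: "'a set set \<Rightarrow> 'a set \<Rightarrow> 'a set set" where
  "trace_family P A = {U \<inter> A |U. U \<in> P}"

end

theory Submission
  imports Defs
begin

text \<open>
  An open set meets the closure of \<open>F\<close> exactly when it meets \<open>F\<close> itself. Hence, for \<open>F \<subseteq> A\<close> and a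
  subbasic open set \<open>U\<close>, the closure of \<open>F\<close> in \<open>T\<close> hits \<open>U\<close> iff \<open>F\<close> hits \<open>U \<inter> A\<close>: along the closure map,
  the subbasic sets of the hyperspace of \<open>T\<close> pull back precisely to the subbasic sets of the
  hyperspace of \<open>A\<close> (\<open>hit_trace_eq_vimage\<close>). So the topology on \<open>CL A\<close> is the
  initial topology for the closure map, and an injective map into a space is an embedding for the
  initial topology (\<open>inj_on_imp_embedding_map_generated\<close>). The closure map is injective because a
  relatively closed subset of \<open>A\<close> is recovered from its closure by intersecting with \<open>A\<close>.
\<close>

text \<open>
  Preimages commute with finite intersections and arbitrary unions, so a correspondence between the
  subbases by preimage extends to all open sets.
\<close>

lemma openin_generated_imp_vimage:
  assumes pullback: "\<And>B. B \<in> \<B> \<Longrightarrow> \<exists>C\<in>\<C>. B = f -` C \<inter> \<Union>\<B>"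
    and "openin (topology_generated_by \<B>) W"
  shows "\<exists>V. openin (topology_generated_by \<C>) V \<and> W = f -` V \<inter> \<Union>\<B>"
proof -
  have "generate_topology_on \<B> W"
    using assms(2) by (rule openin_topology_generated_by)
  then show ?thesis
  proof induction
    case Empty
    show ?case by (intro exI[of _ "{}"]) simp
  next
    case (Int W\<^sub>1 W\<^sub>2)
    then obtain V\<^sub>1 V\<^sub>2
      where "openin (topology_generated_by \<C>) V\<^sub>1" "W\<^sub>1 = f -` V\<^sub>1 \<inter> \<Union>\<B>"
        and "openin (topology_generated_by \<C>) V\<^sub>2" "W\<^sub>2 = f -` V\<^sub>2 \<inter> \<Union>\<B>"
      by blast
    then show ?case
      by (intro exI[of _ "V\<^sub>1 \<inter> V\<^sub>2"]) (auto simp del: Union_iff)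
  next
    case (UN K)
    then obtain V
      where V: "\<And>k. k \<in> K \<Longrightarrow> openin (topology_generated_by \<C>) (V k)"
        and K: "\<And>k. k \<in> K \<Longrightarrow> k = f -` V k \<inter> \<Union>\<B>"
      by metis
    have "\<Union>K = (\<Union>k\<in>K. f -` V k \<inter> \<Union>\<B>)"
      by (intro arg_cong[of _ _ Union]) (subst image_ident[symmetric], rule image_cong[OF refl K])
    also have "\<dots> = f -` \<Union>(V ` K) \<inter> \<Union>\<B>"
      by blast
    finally have "\<Union>K = f -` \<Union>(V ` K) \<inter> \<Union>\<B>" .
    moreover have "openin (topology_generated_by \<C>) (\<Union>(V ` K))"
      using V by blast
    ultimately show ?case by blast
  next
    case (Basis B)
    then show ?case
      using pullback[OF Basis] topology_generated_by_Basis by blast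
  qed
qed

text \<open>
  The last hypothesis makes the topology of the domain the initial topology for \<open>f\<close>. As every open
  set is then a preimage \<open>f -` V\<close> with \<open>V\<close> open, its image is the trace of \<open>V\<close> on the range of \<open>f\<close>,
  which makes \<open>f\<close> open onto its range.
\<close>

lemma inj_on_imp_embedding_map_generated:
  assumes inj: "inj_on f (\<Union>\<B>)"
    and maps: "f ` \<Union>\<B> \<subseteq> \<Union>\<C>"
    and subbase: "\<B> = (\<lambda>C. f -` C \<inter> \<Union>\<B>) ` \<C>"
  shows "embedding_map (topology_generated_by \<B>) (topology_generated_by \<C>) f"
proof -
  let ?X = "topology_generated_by \<B>" and ?Y = "topology_generated_by \<C>"
  have "continuous_map ?X ?Y f"
  proof (rule continuous_on_generated_topo)
    fix C assume "C \<in> \<C>"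
    then have "f -` C \<inter> \<Union>\<B> \<in> \<B>"
      by (intro subsetD[OF equalityD2[OF subbase]] imageI)
    then show "openin ?X (f -` C \<inter> topspace ?X)"
      by (simp only: topology_generated_by_topspace topology_generated_by_Basis)
  qed (use maps in simp)
  moreover have "open_map ?X (subtopology ?Y (f ` \<Union>\<B>)) f"
    unfolding open_map_def
  proof (intro allI impI)
    fix W assume "openin ?X W"
    moreover have "\<exists>C\<in>\<C>. B = f -` C \<inter> \<Union>\<B>" if "B \<in> \<B>" for B
      using subsetD[OF equalityD1[OF subbase] that] by (rule imageE) blast
    ultimately obtain V where "openin ?Y V" and W: "W = f -` V \<inter> \<Union>\<B>"
      using openin_generated_imp_vimage[of \<B> \<C> f W] by blast
    have "f ` W = V \<inter> f ` \<Union>\<B>"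
      unfolding W by blast
    with \<open>openin ?Y V\<close> show "openin (subtopology ?Y (f ` \<Union>\<B>)) (f ` W)"
      by (auto simp: openin_subtopology)
  qed
  moreover have "topspace (subtopology ?Y (f ` \<Union>\<B>)) = f ` \<Union>\<B>"
    using Int_absorb1[OF maps] by (simp only: topspace_subtopology topology_generated_by_topspace)
  ultimately show ?thesis
    unfolding embedding_map_def homeomorphic_map_def topology_generated_by_topspace
    using inj continuous_open_imp_quotient_map[of ?X "subtopology ?Y (f ` \<Union>\<B>)" f]
    by (simp only: continuous_map_in_subtopology topology_generated_by_topspace subset_refl
        image_subset_iff_funcset[symmetric] simp_thms)
qed

lemma inj_on_closure_of_CL_subtopology:
  "inj_on (\<lambda>F. T closure_of F) (CL (subtopology T A))"
proof (rule inj_onI)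
  have recover: "F = A \<inter> T closure_of F" if "F \<in> CL (subtopology T A)" for F
  proof -
    have closed: "closedin (subtopology T A) F"
      using that by (simp add: CL_def)
    then have "F \<subseteq> A"
      using closedin_subset by fastforce
    then show ?thesis
      using closure_of_closedin[OF closed] by (simp add: closure_of_subtopology Int_absorb1)
  qed
  fix F G
  assume "F \<in> CL (subtopology T A)" "G \<in> CL (subtopology T A)" "T closure_of F = T closure_of G"
  then show "F = G"
    using recover by metis
qed

lemma closure_of_in_CL:
  assumes "F \<in> CL (subtopology T A)"
  shows "T closure_of F \<in> CL T"
proof -
  have "F \<subseteq> topspace T" "F \<noteq> {}"
    using assms closedin_subset[of "subtopology T A" F] by (auto simp: CL_def)
  then have "T closure_of F \<noteq> {}"
    using closure_of_subset by blast
  then show ?thesis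
    by (simp add: CL_def)
qed

text \<open>
  Closing up a set \<open>F \<subseteq> A\<close> creates no new intersections with an open set, so hitting \<open>U\<close> after closure is
  decided inside \<open>A\<close>.
\<close>

lemma hit_trace_eq_vimage:
  assumes "openin T U"
  shows "hit (CL (subtopology T A)) (U \<inter> A)
    = (\<lambda>F. T closure_of F) -` hit (CL T) U \<inter> CL (subtopology T A)"
proof -
  have "F \<inter> (U \<inter> A) \<noteq> {} \<longleftrightarrow> (T closure_of F) \<inter> U \<noteq> {}" if "F \<in> CL (subtopology T A)" for F
  proof -
    have "F \<subseteq> A"
      using that closedin_subset[of "subtopology T A" F] by (simp add: CL_def)
    then have "F \<inter> (U \<inter> A) = U \<inter> F"
      by blast
    then show ?thesis
      using openin_Int_closure_of_eq_empty[OF assms, of F] by (simp add: Int_commute)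
  qed
  then show ?thesis
    by (auto simp: hit_def closure_of_in_CL)
qed

theorem theorem3p4:
  fixes T :: "'a topology" and P :: "'a set set" and A :: "'a set"
  assumes "subbase_of T P"
    and "topspace T \<in> P"
    and "A \<subseteq> topspace T"
  shows "embedding_map
           (hit_topology (CL (subtopology T A)) (trace_family P A))
           (hit_topology (CL T) P)
           (\<lambda>F. T closure_of F)"
proof -
  let ?cl = "\<lambda>F. T closure_of F" and ?CLA = "CL (subtopology T A)"
  let ?\<B> = "hit ?CLA ` trace_family P A" and ?\<C> = "hit (CL T) ` P"
  \<comment> \<open>As the whole space belongs to \<open>P\<close>, its trace \<open>A\<close> belongs to \<open>trace_family P A\<close>, so the two hit
      topologies live on all of \<open>CL A\<close> and all of \<open>CL T\<close>.\<close>
  have "topspace (subtopology T A) \<in> trace_family P A"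
    using assms(2) by (auto simp: trace_family_def)
  then have UB: "\<Union>?\<B> = ?CLA"
    unfolding hit_topology_def[symmetric] topology_generated_by_topspace[symmetric]
    by (rule topspace_hit_topology_CL)
  have UC: "\<Union>?\<C> = CL T"
    using topspace_hit_topology_CL[OF assms(2)]
    unfolding hit_topology_def topology_generated_by_topspace .
  have openP: "openin T U" if "U \<in> P" for U
    using topology_generated_by_Basis[OF that] assms(1) by (simp add: subbase_of_def)
  have "?\<B> = (\<lambda>U. hit ?CLA (U \<inter> A)) ` P"
    by (auto simp: trace_family_def)
  also have "\<dots> = (\<lambda>U. ?cl -` hit (CL T) U \<inter> ?CLA) ` P"
    by (intro image_cong refl hit_trace_eq_vimage openP)
  also have "\<dots> = (\<lambda>C. ?cl -` C \<inter> ?CLA) ` ?\<C>"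
    by (simp add: image_image)
  finally have "?\<B> = (\<lambda>C. ?cl -` C \<inter> \<Union>?\<B>) ` ?\<C>"
    unfolding UB .
  moreover have "inj_on ?cl (\<Union>?\<B>)"
    unfolding UB by (rule inj_on_closure_of_CL_subtopology)
  moreover have "?cl ` \<Union>?\<B> \<subseteq> \<Union>?\<C>"
    unfolding UB UC using closure_of_in_CL by blast
  ultimately show ?thesis
    unfolding hit_topology_def by (intro inj_on_imp_embedding_map_generated)
qed

end
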